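(* Let $n \ge 2$ be an integer and let $A_n \in \{0,1\}^{[2]^n \times [2]^{n-1}}$ be the binary single-deletion channel, i.e. $(A_n)_{x,y}=1$ if and only if $y$ can be obtained from $x$ by deleting exactly one symbol. Then \[ \kappa^*(A_n) \le \frac{2^n}{n+1}\left(1 + \frac{26}{n(n-1)}\right). \]
   Context: $[2]=\{0,1\}$ and $[2]^m$ is the set of binary strings of length $m$. For a $0/1$ matrix $A \in \{0,1\}^{X\times Y}$, $\kappa^*(A) = \min\{\mathbf{1}^T z : z \in \mathbb{R}^Y,\ z \ge \mathbf{0},\ Az \ge \mathbf{1}\}$ (entrywise inequalities), the minimum fractional output covering number. *)

theory Defs
  imports Complex_Main
begin

definition bin_strings :: "nat \<Rightarrow> bool list set" where
  "bin_strings m = {xs. length xs = m}"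

definition kappa_star :: "('x \<Rightarrow> 'y \<Rightarrow> bool) \<Rightarrow> 'x set \<Rightarrow> 'y set \<Rightarrow> real" where
  "kappa_star A X Y = Inf {(\<Sum>y\<in>Y. z y) | z.
      (\<forall>y\<in>Y. z y \<ge> 0) \<and> (\<forall>x\<in>X. (\<Sum>y\<in>Y. of_bool (A x y) * z y) \<ge> 1)}"

definition single_deletion :: "bool list \<Rightarrow> bool list \<Rightarrow> bool" where
  "single_deletion x y \<longleftrightarrow> (\<exists>i < length x. y = take i x @ drop (Suc i) x)"

end

theory Submission
  imports Defs
begin

text \<open>
  Give a string with \<open>r\<close> runs, \<open>u\<close> of which are interior runs of length one, the weight
  \<open>f r u = 1 / r - 2 (u - 1) / (r (r + 1) (r + 2))\<close>.
  Deleting the first symbol of each of the \<open>r\<close> runs of a string \<open>x\<close> yields \<open>r\<close> distinct strings.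
  If the run is interior of length one, the result has \<open>r - 2\<close> runs and at most \<open>u - 1\<close> interior
  runs of length one; otherwise its weight is at least \<open>f r (u + 1)\<close>. Since
  \<open>(r - u) f r (u + 1) + u f (r - 2) (u - 1) \<ge> 1\<close>, the weights form a fractional cover.
  The total weight is a combination of sums of \<open>(N choose k) / ((k + 1) (k + 2) (k + 3))\<close> and
  similar terms, which absorption reduces to elementary binomial sums.
\<close>

section \<open>Run boundaries and isolated letters\<close>

text \<open>One less than the number of runs of a nonempty list.\<close>

fun changes :: "'a list \<Rightarrow> nat" where
  "changes (a # b # xs) = of_bool (a \<noteq> b) + changes (b # xs)"
| "changes _ = 0"

text \<open>The number of interior runs of length one; each is the middle letter of a counted
  window.\<close>

fun isolated :: "'a list \<Rightarrow> nat" where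
  "isolated (a # b # c # xs) = of_bool (a \<noteq> b \<and> b \<noteq> c) + isolated (b # c # xs)"
| "isolated _ = 0"

lemma changes_append: "changes (p @ a # q) = changes (p @ [a]) + changes (a # q)"
  by (induction p rule: changes.induct) auto

text \<open>Windows of three letters are counted, so the pieces overlap in two letters and each
  window lies in exactly one of them.\<close>

lemma isolated_append:
  "isolated (p @ a # b # q) = isolated (p @ [a, b]) + isolated (a # b # q)"
proof (induction p rule: isolated.induct)
  case ("2_3" x y)
  then show ?case by (cases q) auto
qed auto

lemma isolated_Cons_le: "isolated (a # xs) \<le> Suc (isolated xs)"
  by (cases "a # xs" rule: isolated.cases) auto

lemma isolated_Cons_ge: "isolated xs \<le> isolated (a # xs)"
  by (cases "a # xs" rule: isolated.cases) auto

lemma isolated_Cons_same: "isolated (a # a # xs) = isolated (a # xs)"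
  by (cases xs) auto

lemma isolated_snoc_ge: "isolated (p @ [a]) \<le> isolated (p @ [a, b])"
  by (induction p rule: isolated.induct) auto

lemma isolated_snoc_same: "isolated (p @ [a, a]) = isolated (p @ [a])"
  by (induction p rule: isolated.induct) auto

text \<open>The first and last runs are not interior; for a constant string both counts are 0, hence
  the premise.\<close>

lemma isolated_less_changes: "isolated xs \<noteq> 0 \<Longrightarrow> isolated xs < changes xs"
proof (induction xs rule: isolated.induct)
  case (1 a b c xs)
  then show ?case by (cases "isolated (b # c # xs) = 0"; cases "b = c") auto
qed auto

section \<open>Deleting the first letter of a run\<close>

definition delete_at :: "nat \<Rightarrow> 'a list \<Rightarrow> 'a list" where
  "delete_at i x = take i x @ drop (Suc i) x"

text \<open>Last positions of all runs but the final one, so the run starts are 0 and the successors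
  of these indices.\<close>

definition change_set :: "'a list \<Rightarrow> nat set" where
  "change_set x = {j. Suc j < length x \<and> x ! j \<noteq> x ! Suc j}"

text \<open>Indexed by the position before the isolated letter, which makes it a subset of
  \<open>change_set x\<close>.\<close>

definition isolated_set :: "'a list \<Rightarrow> nat set" where
  "isolated_set x = {j \<in> change_set x. Suc j \<in> change_set x}"

lemma change_set_Cons:
  "change_set (a # b # xs) = (if a \<noteq> b then {0} else {}) \<union> Suc ` change_set (b # xs)"
proof (intro set_eqI)
  fix j show "j \<in> change_set (a # b # xs) \<longleftrightarrow>
      j \<in> (if a \<noteq> b then {0} else {}) \<union> Suc ` change_set (b # xs)"
    by (cases j) (auto simp: change_set_def)
qed

lemma isolated_set_Cons:
  "isolated_set (a # b # c # xs) =
     (if a \<noteq> b \<and> b \<noteq> c then {0} else {}) \<union> Suc ` isolated_set (b # c # xs)"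
proof (intro set_eqI)
  fix j show "j \<in> isolated_set (a # b # c # xs) \<longleftrightarrow>
      j \<in> (if a \<noteq> b \<and> b \<noteq> c then {0} else {}) \<union> Suc ` isolated_set (b # c # xs)"
    by (cases j) (auto simp: change_set_def isolated_set_def)
qed

lemma finite_change_set: "finite (change_set x)"
  by (rule finite_subset[of _ "{..<length x}"]) (auto simp: change_set_def)

lemma finite_isolated_set: "finite (isolated_set x)"
  using finite_change_set[of x] by (simp add: isolated_set_def)

lemma card_change_set: "card (change_set x) = changes x"
proof (induction x rule: changes.induct)
  case (1 a b xs)
  then show ?case
    by (auto simp: change_set_Cons card_insert_if card_image finite_change_set)
qed (auto simp: change_set_def)

lemma card_isolated_set: "card (isolated_set x) = isolated x"
proof (induction x rule: isolated.induct)
  case (1 a b c xs)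
  then show ?case
    by (auto simp: isolated_set_Cons card_insert_if card_image finite_isolated_set)
qed (auto simp: isolated_set_def change_set_def)

lemma change_set_split:
  assumes "j \<in> change_set x"
  obtains p a c q where "x = p @ a # c # q" "length p = j" "a \<noteq> c"
    "delete_at (Suc j) x = p @ a # q"
proof
  have j: "Suc j < length x" "x ! j \<noteq> x ! Suc j" using assms by (auto simp: change_set_def)
  have "x = take j x @ x ! j # drop (Suc j) x"
    using j by (simp add: id_take_nth_drop)
  also have "drop (Suc j) x = x ! Suc j # drop (Suc (Suc j)) x"
    using j by (simp add: Cons_nth_drop_Suc)
  finally show "x = take j x @ x ! j # x ! Suc j # drop (Suc (Suc j)) x" .
  show "length (take j x) = j" "x ! j \<noteq> x ! Suc j" using j by auto
  show "delete_at (Suc j) x = take j x @ x ! j # drop (Suc (Suc j)) x"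
    using j by (simp add: delete_at_def take_Suc_conv_app_nth)
qed

text \<open>Position \<open>Suc j\<close> starts a run, so the two strings differ at position \<open>j\<close>.\<close>

lemma delete_at_neq:
  assumes "j \<in> change_set x" "i \<le> j"
  shows "delete_at i x \<noteq> delete_at (Suc j) x"
proof
  have j: "Suc j < length x" "x ! j \<noteq> x ! Suc j" using assms by (auto simp: change_set_def)
  assume "delete_at i x = delete_at (Suc j) x"
  then have "delete_at i x ! j = delete_at (Suc j) x ! j" by simp
  moreover have "delete_at i x ! j = x ! Suc j"
    using assms(2) j by (simp add: delete_at_def nth_append min_def)
  moreover have "delete_at (Suc j) x ! j = x ! j"
    using j by (simp add: delete_at_def nth_append)
  ultimately show False using j by simp
qed

lemma inj_on_delete_at: "inj_on (\<lambda>i. delete_at i x) (insert 0 (Suc ` change_set x))"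
proof (rule linorder_inj_onI')
  fix i k assume "i \<in> insert 0 (Suc ` change_set x)" "k \<in> insert 0 (Suc ` change_set x)" "i < k"
  then obtain j where "k = Suc j" "j \<in> change_set x" "i \<le> j" by auto
  then show "delete_at i x \<noteq> delete_at k x" using delete_at_neq by metis
qed

text \<open>Over a binary alphabet both neighbours of the isolated letter \<open>c\<close> equal
  \<open>a\<close>. Deleting \<open>c\<close> merges their runs, losing two boundaries; the merged
  run has length at least two, so nothing new becomes isolated.\<close>

lemma delete_isolated:
  fixes x :: "bool list"
  assumes "j \<in> isolated_set x"
  shows "changes (delete_at (Suc j) x) + 2 = changes x"
    and "isolated (delete_at (Suc j) x) + 1 \<le> isolated x"
proof -
  have *: "j \<in> change_set x" "Suc j \<in> change_set x" using assms by (auto simp: isolated_set_def)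
  obtain p a c q where x: "x = p @ a # c # q" "length p = j" "a \<noteq> c"
    and d: "delete_at (Suc j) x = p @ a # q" using change_set_split[OF *(1)] .
  obtain q' where q: "q = a # q'"
    using *(2) x by (cases q) (auto simp: change_set_def nth_append)
  show "changes (delete_at (Suc j) x) + 2 = changes x"
    using x(3) changes_append[of p a "a # q'"] changes_append[of p a "c # a # q'"]
    unfolding d by (auto simp: x(1) q)
  have "isolated (delete_at (Suc j) x) = isolated (p @ [a]) + isolated (a # q')"
    using isolated_append[of p a a q'] unfolding d q
    by (simp add: isolated_snoc_same isolated_Cons_same)
  moreover have "isolated x = isolated (p @ [a, c]) + (1 + isolated (c # a # q'))"
    using x(3) isolated_append[of p a c "a # q'"] by (auto simp: x(1) q)
  ultimately show "isolated (delete_at (Suc j) x) + 1 \<le> isolated x"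
    using isolated_snoc_ge[of p a c] isolated_Cons_ge[of "a # q'" c] by simp
qed

text \<open>Either a final run of length one vanishes with its boundary, or a longer run is
  shortened, which may leave one new isolated letter.\<close>

lemma delete_nonisolated:
  fixes x :: "bool list"
  assumes "j \<in> change_set x" "j \<notin> isolated_set x"
  defines "d \<equiv> delete_at (Suc j) x"
  shows "(changes d = changes x \<and> isolated d \<le> isolated x + 1) \<or>
         (changes d + 1 = changes x \<and> isolated d \<le> isolated x)"
proof -
  obtain p a c q where x: "x = p @ a # c # q" "length p = j" "a \<noteq> c"
    and d: "d = p @ a # q" using change_set_split[OF assms(1)] unfolding d_def .
  have *: "Suc j \<notin> change_set x" using assms by (auto simp: isolated_set_def)
  show ?thesis
  proof (cases q)
    case Nil
    then show ?thesis using isolated_snoc_ge[of p a c] x d changes_append[of p a "[c]"]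
      by simp
  next
    case (Cons b q')
    \<comment> \<open>The run does not end at \<open>Suc j\<close>, so its second letter repeats the
      first.\<close>
    then have [simp]: "b = c" using * x by (auto simp: change_set_def nth_append)
    have "changes d = changes x"
      using Cons changes_append[of p a "c # q'"] changes_append[of p a "c # c # q'"]
      by (simp add: d x(1))
    moreover have "isolated d \<le> isolated x + 1"
      using Cons isolated_Cons_le[of a "c # q'"] isolated_append[of p a c q']
        isolated_append[of p a c "c # q'"]
      by (simp add: d x(1) isolated_Cons_same)
    ultimately show ?thesis by simp
  qed
qed

lemma delete_first:
  assumes "length x \<ge> 2"
  defines "d \<equiv> delete_at 0 x"
  shows "(changes d = changes x \<and> isolated d \<le> isolated x + 1) \<or>
         (changes d + 1 = changes x \<and> isolated d \<le> isolated x)"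
proof -
  obtain a b xs where x: "x = a # b # xs"
    using assms(1) by (metis Suc_le_length_iff numeral_2_eq_2)
  show ?thesis using isolated_Cons_ge[of "b # xs" a]
    by (auto simp: x d_def delete_at_def)
qed

section \<open>The weight and its inequalities\<close>

text \<open>The function \<open>f\<close> above, with \<open>k = r - 1\<close> the number of changes between runs.\<close>

definition weight :: "nat \<Rightarrow> nat \<Rightarrow> real" where
  "weight k u = 1 / (real k + 1) -
     2 * (real u - 1) / ((real k + 1) * (real k + 2) * (real k + 3))"

lemma weight_antimono: "u \<le> v \<Longrightarrow> weight k v \<le> weight k u"
  unfolding weight_def by (intro diff_left_mono divide_right_mono) auto

lemma weight_nonneg:
  assumes "u \<le> k"
  shows "weight k u \<ge> 0"
proof -
  have "weight k u =
      ((real k + 2) * (real k + 3) - 2 * (real u - 1)) / ((real k + 1) * (real k + 2) * (real k + 3))"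
    by (simp add: weight_def divide_simps)
  moreover have "(real k + 2) * (real k + 3) \<ge> 2 * (real u - 1)"
    using assms by (simp add: algebra_simps) (smt (verit) of_nat_0_le_iff of_nat_mono mult_nonneg_nonneg)
  ultimately show ?thesis by simp
qed

lemma weight_Suc_Suc_le:
  assumes "u \<le> Suc k"
  shows "weight (Suc k) (Suc u) \<le> weight k u"
proof -
  have "weight k u - weight (Suc k) (Suc u) =
      ((real k + 5) * (real k + 4) - 6 * real u) /
      ((real k + 1) * (real k + 2) * (real k + 3) * (real k + 4))"
    unfolding weight_def by (simp add: divide_simps) (simp add: algebra_simps)
  moreover have "6 * real u \<le> (real k + 5) * (real k + 4)"
    using assms by (simp add: algebra_simps) (smt (verit) of_nat_0_le_iff of_nat_mono mult_nonneg_nonneg of_nat_Suc)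
  ultimately show ?thesis by (smt (verit) divide_nonneg_nonneg of_nat_0_le_iff mult_nonneg_nonneg)
qed

text \<open>With \<open>k + 1\<close> runs, \<open>u\<close> of them isolated, the left side is the
  total weight guaranteed by deleting one letter from each run.\<close>

lemma weight_cover_ineq:
  assumes "u \<noteq> 0 \<Longrightarrow> u < k"
  shows "(real k + 1 - real u) * weight k (u + 1) + real u * weight (k - 2) (u - 1) \<ge> 1"
proof (cases "u = 0")
  case True
  \<comment> \<open>\<open>weight k 1\<close> is exactly \<open>1 / (k + 1)\<close>: the offset
    \<open>u - 1\<close> in the weight makes this case tight.\<close>
  then show ?thesis by (simp add: weight_def)
next
  case False
  \<comment> \<open>The substitution removes the truncated subtractions.\<close>
  then obtain s v where s: "k = s + 2" "u = v + 1" "v \<le> s"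
    using assms by (metis add_2_eq_Suc' Suc_eq_plus1 Suc_leI Suc_le_D Suc_less_eq less_Suc_eq_le not0_implies_Suc)
  let ?s = "real s" and ?v = "real v"
  have k: "real k = ?s + 2" "real u = ?v + 1" "k - 2 = s" "u - 1 = v" "real (u + 1) = ?v + 2"
    using s by auto
  have "(real k + 1 - real u) * weight k (u + 1) + real u * weight (k - 2) (u - 1) - 1 =
     2 * (?v + 1) * ((?s + 3 - ?v) * ((?s + 4) * (?s + 5)) - (?s + 2 - ?v) * ((?s + 1) * (?s + 2))) /
     ((?s + 1) * (?s + 2) * (?s + 3) * (?s + 4) * (?s + 5))"
    unfolding weight_def k by (simp add: divide_simps) algebra
  moreover have "(?s + 2 - ?v) * ((?s + 1) * (?s + 2)) \<le> (?s + 3 - ?v) * ((?s + 4) * (?s + 5))"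
    using s(3) by (intro mult_mono) auto
  then have "2 * (?v + 1) * ((?s + 3 - ?v) * ((?s + 4) * (?s + 5)) - (?s + 2 - ?v) * ((?s + 1) * (?s + 2))) /
     ((?s + 1) * (?s + 2) * (?s + 3) * (?s + 4) * (?s + 5)) \<ge> 0"
    by (intro divide_nonneg_nonneg mult_nonneg_nonneg) auto
  ultimately show ?thesis by linarith
qed

text \<open>Losing a boundary is no worse than gaining an isolated letter, so one lower bound serves
  both outcomes.\<close>

lemma delete_at_weight:
  fixes x :: "bool list"
  assumes "(changes d = changes x \<and> isolated d \<le> isolated x + 1) \<or>
         (changes d + 1 = changes x \<and> isolated d \<le> isolated x)"
  shows "weight (changes x) (isolated x + 1) \<le> weight (changes d) (isolated d)"
  using assms
proof
  assume "changes d = changes x \<and> isolated d \<le> isolated x + 1"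
  then show ?thesis by (simp add: weight_antimono)
next
  assume *: "changes d + 1 = changes x \<and> isolated d \<le> isolated x"
  have "isolated x \<le> Suc (changes d)"
    using isolated_less_changes[of x] * by (cases "isolated x = 0") auto
  then have "weight (changes x) (isolated x + 1) \<le> weight (changes d) (isolated x)"
    using weight_Suc_Suc_le[of "isolated x" "changes d"] * by simp
  also have "\<dots> \<le> weight (changes d) (isolated d)" using * by (simp add: weight_antimono)
  finally show ?thesis .
qed

section \<open>The weights form a fractional cover\<close>

text \<open>The run starts split into position 0, the \<open>k - u\<close> later ones that are not
  isolated, and the \<open>u\<close> isolated ones, matching
  \<open>weight_cover_ineq\<close>.\<close>

lemma weight_run_deletions:
  fixes x :: "bool list"
  assumes "length x \<ge> 2"
  defines "w \<equiv> \<lambda>y :: bool list. weight (changes y) (isolated y)"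
  shows "(\<Sum>i\<in>insert 0 (Suc ` change_set x). w (delete_at i x)) \<ge> 1"
proof -
  let ?B = "change_set x" and ?C = "isolated_set x"
  let ?k = "changes x" and ?u = "isolated x"
  have sub: "?C \<subseteq> ?B" by (auto simp: isolated_set_def)
  have C: "w (delete_at (Suc j) x) \<ge> weight (?k - 2) (?u - 1)" if "j \<in> ?C" for j
  proof -
    have "changes (delete_at (Suc j) x) = ?k - 2" "isolated (delete_at (Suc j) x) \<le> ?u - 1"
      using delete_isolated[OF that] by auto
    then show ?thesis by (simp add: w_def weight_antimono)
  qed
  have BC: "w (delete_at (Suc j) x) \<ge> weight ?k (?u + 1)" if "j \<in> ?B - ?C" for j
    using delete_at_weight[OF delete_nonisolated[of j x]] that by (simp add: w_def)
  have "w (delete_at 0 x) \<ge> weight ?k (?u + 1)"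
    using delete_at_weight[OF delete_first[OF assms(1)]] by (simp add: w_def)
  moreover have "(\<Sum>j\<in>?C. w (delete_at (Suc j) x)) \<ge> real ?u * weight (?k - 2) (?u - 1)"
    using sum_mono[of ?C "\<lambda>_. weight (?k - 2) (?u - 1)", OF C] by (simp add: card_isolated_set)
  moreover have "(\<Sum>j\<in>?B - ?C. w (delete_at (Suc j) x)) \<ge> (real ?k - real ?u) * weight ?k (?u + 1)"
  proof -
    have "real (card (?B - ?C)) = real ?k - real ?u"
      using card_mono[OF finite_change_set sub] card_Diff_subset[OF finite_isolated_set sub]
      by (simp add: card_isolated_set card_change_set of_nat_diff)
    then show ?thesis
      using sum_mono[of "?B - ?C" "\<lambda>_. weight ?k (?u + 1)", OF BC] by simp
  qed
  moreover have "(\<Sum>i\<in>insert 0 (Suc ` ?B). w (delete_at i x)) =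
      w (delete_at 0 x) + ((\<Sum>j\<in>?B - ?C. w (delete_at (Suc j) x)) + (\<Sum>j\<in>?C. w (delete_at (Suc j) x)))"
    by (simp add: sum.subset_diff[OF sub finite_change_set, symmetric] finite_change_set sum.reindex)
  moreover have "(real ?k + 1 - real ?u) * weight ?k (?u + 1) + real ?u * weight (?k - 2) (?u - 1) \<ge> 1"
    using weight_cover_ineq isolated_less_changes by blast
  ultimately show ?thesis by (simp add: algebra_simps)
qed

lemma weight_changes_isolated_nonneg: "weight (changes y) (isolated y) \<ge> 0"
  using isolated_less_changes[of y] by (intro weight_nonneg) (cases "isolated y = 0"; auto)

lemma finite_bin_strings: "finite (bin_strings m)"
  using finite_lists_length_eq[of "UNIV :: bool set" m] by (simp add: bin_strings_def)

text \<open>Deletions at run starts give distinct strings whose weights already reach 1;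
  nonnegativity extends the bound to all outputs.\<close>

lemma weight_covers:
  assumes "n \<ge> 2" "x \<in> bin_strings n"
  shows "(\<Sum>y\<in>bin_strings (n - 1).
      of_bool (single_deletion x y) * weight (changes y) (isolated y)) \<ge> 1"
proof -
  let ?P = "insert 0 (Suc ` change_set x)"
  have len: "length x = n" using assms by (simp add: bin_strings_def)
  have P: "i < length x" if "i \<in> ?P" for i
    using that assms(1) len by (auto simp: change_set_def)
  have sub: "(\<lambda>i. delete_at i x) ` ?P \<subseteq> {y \<in> bin_strings (n - 1). single_deletion x y}"
  proof (intro image_subsetI)
    fix i assume "i \<in> ?P"
    then have "i < length x" by (rule P)
    then show "delete_at i x \<in> {y \<in> bin_strings (n - 1). single_deletion x y}"
      using len by (auto simp: bin_strings_def single_deletion_def delete_at_def)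
  qed
  have "1 \<le> (\<Sum>i\<in>?P. weight (changes (delete_at i x)) (isolated (delete_at i x)))"
    using weight_run_deletions[of x] assms(1) len by simp
  also have "\<dots> = (\<Sum>y\<in>(\<lambda>i. delete_at i x) ` ?P. weight (changes y) (isolated y))"
    by (simp only: sum.reindex[OF inj_on_delete_at] comp_def)
  also have "\<dots> \<le> (\<Sum>y\<in>{y \<in> bin_strings (n - 1). single_deletion x y}. weight (changes y) (isolated y))"
    using sub weight_changes_isolated_nonneg finite_bin_strings by (intro sum_mono2) auto
  also have "\<dots> = (\<Sum>y\<in>bin_strings (n - 1).
      of_bool (single_deletion x y) * weight (changes y) (isolated y))"
    unfolding sum.inter_filter[OF finite_bin_strings] by (intro sum.cong) auto
  finally show ?thesis .
qed

lemma kappa_star_le: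
  assumes "\<And>y. y \<in> Y \<Longrightarrow> z y \<ge> 0"
    and "\<And>x. x \<in> X \<Longrightarrow> (\<Sum>y\<in>Y. of_bool (A x y) * z y) \<ge> 1"
  shows "kappa_star A X Y \<le> (\<Sum>y\<in>Y. z y)"
  unfolding kappa_star_def
proof (rule cInf_lower)
  show "bdd_below {(\<Sum>y\<in>Y. z y) | z. (\<forall>y\<in>Y. z y \<ge> 0) \<and>
      (\<forall>x\<in>X. (\<Sum>y\<in>Y. of_bool (A x y) * z y) \<ge> (1::real))}"
    by (rule bdd_belowI[of _ 0]) (auto intro: sum_nonneg)
qed (use assms in blast)

section \<open>Binomial sums and absorption\<close>

text \<open>The binomial transform: \<open>binsum N f\<close> is the sum of \<open>(N choose k) * f k\<close> over \<open>k \<le> N\<close>.\<close>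

primrec binsum :: "nat \<Rightarrow> (nat \<Rightarrow> real) \<Rightarrow> real" where
  "binsum 0 f = f 0"
| "binsum (Suc N) f = binsum N f + binsum N (\<lambda>k. f (Suc k))"

lemma binsum_add: "binsum N (\<lambda>k. f k + g k) = binsum N f + binsum N g"
  by (induction N arbitrary: f g) auto

lemma binsum_diff: "binsum N (\<lambda>k. f k - g k) = binsum N f - binsum N g"
  by (induction N arbitrary: f g) auto

lemma binsum_cmult: "binsum N (\<lambda>k. c * f k) = c * binsum N f"
  by (induction N arbitrary: f) (auto simp: algebra_simps)

lemma binsum_mono: "(\<And>k. f k \<le> g k) \<Longrightarrow> binsum N f \<le> binsum N g"
  by (induction N arbitrary: f g) (auto intro: add_mono)

lemma binsum_const: "binsum N (\<lambda>_. c) = c * 2 ^ N"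
  by (induction N) auto

lemma binsum_linear: "binsum N (\<lambda>k. real k) = real N * 2 ^ N / 2"
proof (induction N)
  case (Suc N)
  have "binsum N (\<lambda>k. real (Suc k)) = binsum N (\<lambda>k. real k) + 2 ^ N"
    using binsum_add[of N "\<lambda>k. real k" "\<lambda>_. 1"] binsum_const[of N 1] by (simp add: add.commute)
  then show ?case using Suc by (simp add: field_simps)
qed simp

lemma binsum_square: "binsum N (\<lambda>k. real k * real k) = real N * (real N + 1) * 2 ^ N / 4"
proof (induction N)
  case (Suc N)
  have "binsum N (\<lambda>k. real (Suc k) * real (Suc k)) =
      binsum N (\<lambda>k. real k * real k + (2 * real k + 1))"
    by (rule arg_cong[where f = "binsum N"]) (auto simp: algebra_simps)
  also have "\<dots> = binsum N (\<lambda>k. real k * real k) + real N * 2 ^ N + 2 ^ N"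
    by (simp add: binsum_add binsum_cmult binsum_const binsum_linear)
  finally show ?case using Suc by (simp add: field_simps)
qed simp

text \<open>The absorption identity \<open>(N + 1) * (N choose k) = (k + 1) * (N + 1 choose k + 1)\<close>.\<close>

lemma binsum_absorb: "(real N + 1) * binsum N f = binsum (Suc N) (\<lambda>k. real k * f (k - 1))"
proof (induction N arbitrary: f)
  case (Suc N)
  have "binsum (Suc N) (\<lambda>k. real (Suc k) * f (Suc k - 1)) =
      binsum (Suc N) (\<lambda>k. real k * f (Suc (k - 1)) + f k)"
  proof (rule arg_cong[where f = "binsum (Suc N)"], rule ext)
    show "real (Suc k) * f (Suc k - 1) = real k * f (Suc (k - 1)) + f k" for k
      by (cases k) (auto simp: algebra_simps)
  qed
  also have "\<dots> = (real N + 1) * binsum N (\<lambda>k. f (Suc k)) + binsum (Suc N) f"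
    using Suc[of "\<lambda>k. f (Suc k)"] by (simp only: binsum_add)
  finally show ?case using Suc[of f]
    unfolding binsum.simps(2)[of "Suc N" "\<lambda>k. real k * f (k - 1)"]
    by (simp add: algebra_simps)
qed simp

text \<open>The product on the right is the falling factorial of \<open>k\<close>; it vanishes for
  \<open>k < j\<close>, exactly where \<open>k - j\<close> is truncated.\<close>

lemma binsum_absorb_iter:
  "(\<Prod>i<j. real N + 1 + real i) * binsum N f =
     binsum (N + j) (\<lambda>k. (\<Prod>i<j. real k - real i) * f (k - j))"
proof (induction j)
  case (Suc j)
  have "(\<Prod>i<Suc j. real N + 1 + real i) * binsum N f = (real (N + j) + 1) *
      binsum (N + j) (\<lambda>k. (\<Prod>i<j. real k - real i) * f (k - j))"
    using Suc by (simp add: algebra_simps)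
  also have "\<dots> = binsum (Suc (N + j)) (\<lambda>k. real k * ((\<Prod>i<j. real (k - 1) - real i) * f (k - 1 - j)))"
    by (rule binsum_absorb)
  also have "\<dots> = binsum (N + Suc j) (\<lambda>k. (\<Prod>i<Suc j. real k - real i) * f (k - Suc j))"
  proof (simp only: add_Suc_right, rule arg_cong[where f = "binsum (Suc (N + j))"], rule ext)
    show "real k * ((\<Prod>i<j. real (k - 1) - real i) * f (k - 1 - j)) =
        (\<Prod>i<Suc j. real k - real i) * f (k - Suc j)" for k
      by (cases k) (auto simp: prod.lessThan_Suc_shift simp del: prod.lessThan_Suc)
  qed
  finally show ?case .
qed simp

section \<open>Sums over binary strings\<close>

lemma bin_strings_Suc: "bin_strings (Suc N) = (#) True ` bin_strings N \<union> (#) False ` bin_strings N"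
proof (intro set_eqI)
  show "xs \<in> bin_strings (Suc N) \<longleftrightarrow>
      xs \<in> (#) True ` bin_strings N \<union> (#) False ` bin_strings N" for xs
    by (cases xs) (auto simp: bin_strings_def image_iff)
qed

text \<open>Relative to a preceding letter \<open>a\<close>, one summand repeats it and the other
  changes it, as in the recursion of \<open>binsum\<close>.\<close>

lemma sum_bin_strings_Suc:
  "(\<Sum>xs\<in>bin_strings (Suc N). f xs) =
     (\<Sum>xs\<in>bin_strings N. f (a # xs)) + (\<Sum>xs\<in>bin_strings N. (f ((\<not> a) # xs) :: real))"
proof -
  have "(\<Sum>xs\<in>bin_strings (Suc N). f xs) =
      (\<Sum>xs\<in>bin_strings N. f (True # xs)) + (\<Sum>xs\<in>bin_strings N. f (False # xs))"
    unfolding bin_strings_Suc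
    by (subst sum.union_disjoint) (auto simp: finite_bin_strings sum.reindex)
  then show ?thesis by (cases a) auto
qed

lemma bin_strings_0: "bin_strings 0 = {[]}"
  by (auto simp: bin_strings_def)

text \<open>Once the first letter is fixed, each of the other \<open>N\<close> letters freely
  repeats or changes its predecessor.\<close>

lemma sum_changes:
  "(\<Sum>xs\<in>bin_strings N. f (changes (a # xs))) = binsum N f"
proof (induction N arbitrary: a f)
  case (Suc N)
  show ?case using Suc[of f a] Suc[of "\<lambda>k. f (Suc k)" "\<not> a"]
    by (simp add: sum_bin_strings_Suc[of _ _ a])
qed (simp add: bin_strings_0)

text \<open>Double counting: of the \<open>M + 1\<close> interior positions, isolating one forces
  two of the \<open>M + 2\<close> transitions to be changes and leaves \<open>M\<close>
  free.\<close>

lemma sum_changes_isolated: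
  "(\<Sum>xs\<in>bin_strings (Suc (Suc M)). f (changes (a # xs)) * real (isolated (a # xs))) =
     (real M + 1) * binsum M (\<lambda>k. f (k + 2))"
proof (induction M arbitrary: a f)
  case 0
  show ?case by (simp add: sum_bin_strings_Suc[of _ _ a] bin_strings_0)
next
  case (Suc M)
  let ?N = "Suc M"
  have 1: "(\<Sum>xs\<in>bin_strings (Suc ?N). f (changes (a # a # xs)) * real (isolated (a # a # xs))) =
      (real M + 1) * binsum M (\<lambda>k. f (k + 2))"
    using Suc[of f a] by (simp add: isolated_Cons_same)
  \<comment> \<open>The second sum collects the strings whose second letter is isolated because the
    third is \<open>a\<close> again.\<close>
  have "(\<Sum>xs\<in>bin_strings (Suc ?N). f (changes (a # (\<not> a) # xs)) * real (isolated (a # (\<not> a) # xs))) =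
      (\<Sum>xs\<in>bin_strings (Suc ?N). f (Suc (changes ((\<not> a) # xs))) * real (isolated ((\<not> a) # xs))) +
      (\<Sum>xs\<in>bin_strings ?N. f (Suc (Suc (changes (a # xs)))))"
    by (simp add: sum_bin_strings_Suc[of _ _ a] isolated_Cons_same sum.distrib algebra_simps)
  also have "\<dots> = (real M + 1) * binsum M (\<lambda>k. f (Suc (k + 2))) + binsum ?N (\<lambda>k. f (k + 2))"
    using Suc[of "\<lambda>k. f (Suc k)" "\<not> a"] sum_changes[of "\<lambda>k. f (Suc (Suc k))" a ?N] by simp
  finally show ?case using 1 by (simp add: sum_bin_strings_Suc[of _ "Suc ?N" a] algebra_simps)
qed

section \<open>Estimates of the binomial sums\<close>

lemma prod_lessThan_numeral:
  fixes f :: "nat \<Rightarrow> real"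
  shows "(\<Prod>i<3. f i) = f 0 * f 1 * f 2" "(\<Prod>i<5. f i) = f 0 * f 1 * f 2 * f 3 * f 4"
  by (simp_all add: numeral_eq_Suc lessThan_Suc)

text \<open>After absorption the summand is 1, except at \<open>k = 0\<close>, where it is
  0.\<close>

lemma binsum_inverse: "(real N + 1) * binsum N (\<lambda>k. 1 / (real k + 1)) \<le> 2 ^ Suc N"
proof -
  have "(real N + 1) * binsum N (\<lambda>k. 1 / (real k + 1)) \<le> binsum (Suc N) (\<lambda>_. 1)"
    unfolding binsum_absorb
  proof (rule binsum_mono)
    show "real k * (1 / (real (k - 1) + 1)) \<le> 1" for k by (cases k) auto
  qed
  then show ?thesis by (simp only: binsum_const mult_1)
qed

definition recip3 :: "nat \<Rightarrow> real" where
  "recip3 k = 1 / ((real k + 1) * (real k + 2) * (real k + 3))"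

text \<open>Three absorptions cancel the denominator: the summand becomes 1 for
  \<open>k \<ge> 3\<close> and 0 below.\<close>

lemma binsum_recip3:
  "(real N + 1) * (real N + 2) * (real N + 3) * binsum N recip3 \<le> 2 ^ (N + 3)"
proof -
  have "(\<Prod>i<3. real N + 1 + real i) * binsum N recip3 \<le> binsum (N + 3) (\<lambda>_. 1)"
    unfolding binsum_absorb_iter
  proof (rule binsum_mono)
    show "(\<Prod>i<3. real k - real i) * recip3 (k - 3) \<le> 1" for k
    proof (cases "k < 3")
      case True
      then have "k = 0 \<or> k = 1 \<or> k = 2" by auto
      then show ?thesis by (auto simp: prod_lessThan_numeral)
    next
      case False
      then obtain l where "k = l + 3" by (metis add.commute le_Suc_ex not_less)
      then show ?thesis by (simp add: prod_lessThan_numeral recip3_def divide_simps algebra_simps)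
    qed
  qed
  then show ?thesis by (simp add: prod_lessThan_numeral binsum_const algebra_simps)
qed

text \<open>The correction at small arguments that turns the polynomial \<open>(i - 4) * (i - 3)\<close> into a
  function vanishing for \<open>i < 5\<close>.\<close>

definition low_corr :: "nat \<Rightarrow> real" where
  "low_corr i = (if i = 0 then 12 else if i = 1 then 6 else if i = 2 then 2 else 0)"

text \<open>Equality holds at \<open>M = 0\<close>, where 12 + 3 * 6 + 3 * 2 = 36; as
  \<open>low_corr\<close> is nonincreasing, each step at most doubles the sum.\<close>

lemma binsum_low_corr: "binsum (M + 3) low_corr \<le> 9 / 2 * 2 ^ (M + 3)"
proof (induction M)
  case 0
  show ?case by (simp add: numeral_3_eq_3 low_corr_def)
next
  case (Suc M)
  have "binsum (M + 3) (\<lambda>k. low_corr (Suc k)) \<le> binsum (M + 3) low_corr"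
    by (rule binsum_mono) (simp add: low_corr_def)
  then show ?case using Suc unfolding add_Suc binsum.simps(2) power_Suc by linarith
qed

text \<open>Five absorptions turn the summand into \<open>(i - 3) * (i - 4) - low_corr i\<close>;
  the first two binomial moments evaluate the polynomial.\<close>

lemma binsum_recip3_shift:
  fixes M :: nat
  defines "m \<equiv> real M"
  shows "(m + 1) * (m + 2) * (m + 3) * (m + 4) * (m + 5) * binsum M (\<lambda>k. recip3 (k + 2)) \<ge>
    2 ^ (M + 5) * ((m + 5) * (m + 6) / 4 - 7 * (m + 5) / 2 + 15 / 2)"
proof -
  let ?L = "M + 5"
  have "(\<Prod>i<5. m + 1 + real i) * binsum M (\<lambda>k. recip3 (k + 2)) =
      binsum ?L (\<lambda>i. ((real i * real i - 7 * real i) + 12) - low_corr i)"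
    unfolding binsum_absorb_iter m_def
  proof (rule arg_cong[where f = "binsum ?L"], rule ext)
    show "(\<Prod>i<5. real k - real i) * recip3 (k - 5 + 2) =
        ((real k * real k - 7 * real k) + 12) - low_corr k" for k
    proof (cases "k < 5")
      case True
      then have "k = 0 \<or> k = 1 \<or> k = 2 \<or> k = 3 \<or> k = 4" by auto
      then show ?thesis by (auto simp: prod_lessThan_numeral low_corr_def)
    next
      case False
      then obtain l where "k = l + 5" by (metis add.commute le_Suc_ex not_less)
      then show ?thesis
        by (simp add: prod_lessThan_numeral recip3_def low_corr_def divide_simps) (simp add: algebra_simps)
    qed
  qed
  also have "\<dots> = 2 ^ ?L * ((m + 5) * (m + 6) / 4 - 7 * (m + 5) / 2 + 12) - binsum ?L low_corr"
    by (simp only: binsum_add binsum_diff binsum_cmult binsum_const binsum_linear binsum_square)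
      (simp add: m_def field_simps)
  \<comment> \<open>The correction costs 9/2, which turns the constant 12 into 15/2.\<close>
  also have "\<dots> \<ge> 2 ^ ?L * ((m + 5) * (m + 6) / 4 - 7 * (m + 5) / 2 + 12) - 9 / 2 * 2 ^ ?L"
    using binsum_low_corr[of "M + 2"] by (simp add: numeral_eq_Suc)
  finally show ?thesis by (simp add: prod_lessThan_numeral algebra_simps)
qed

section \<open>The total weight\<close>

lemma weight_recip3: "weight k u = (1 / (real k + 1) + 2 * recip3 k) - 2 * (recip3 k * real u)"
  by (simp add: weight_def recip3_def diff_divide_distrib algebra_simps)

lemma sum_weight_Cons:
  "(\<Sum>xs\<in>bin_strings N. weight (changes (a # xs)) (isolated (a # xs))) =
     binsum N (\<lambda>k. 1 / (real k + 1)) + 2 * binsum N recip3 -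
     2 * (\<Sum>xs\<in>bin_strings N. recip3 (changes (a # xs)) * real (isolated (a # xs)))"
  unfolding weight_recip3 sum_subtractf sum_distrib_left[symmetric]
    sum_changes[of "\<lambda>k. 1 / (real k + 1) + 2 * recip3 k"] binsum_add binsum_cmult ..

text \<open>Here \<open>n\<close> is the input length of the channel: the strings
  \<open>a # xs\<close> have length \<open>N + 1 = n - 1\<close>.\<close>

lemma sum_weight_Cons_le:
  fixes N :: nat
  defines "n \<equiv> real N + 2"
  shows "(\<Sum>xs\<in>bin_strings N. weight (changes (a # xs)) (isolated (a # xs))) \<le>
     2 ^ (N + 1) / (n + 1) * (1 + 26 / (n * (n - 1)))"
proof -
  define P where "P = (2::real) ^ N"
  define S where "S = (\<Sum>xs\<in>bin_strings N. recip3 (changes (a # xs)) * real (isolated (a # xs)))"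
  have P: "P > 0" by (simp add: P_def)
  have n: "n \<ge> 2" by (simp add: n_def)
  have 1: "(n - 1) * binsum N (\<lambda>k. 1 / (real k + 1)) \<le> 2 * P"
    using binsum_inverse[of N] by (simp add: n_def P_def add.commute)
  have 2: "(n - 1) * n * (n + 1) * binsum N recip3 \<le> 8 * P"
    using binsum_recip3[of N] by (simp add: n_def P_def add.commute power_add)
  have 3: "(n - 1) * n * (n + 1) * S \<ge> 2 * P * (n - 9)"
  proof (cases "N \<ge> 2")
    \<comment> \<open>Now \<open>n \<le> 3\<close>, so the right side is negative.\<close>
    case False
    have "S \<ge> 0" by (auto simp: S_def recip3_def intro: sum_nonneg)
    then have "(n - 1) * n * (n + 1) * S \<ge> 0" using n by simp
    moreover have "2 * P * (n - 9) \<le> 0"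
      using False P by (intro mult_nonneg_nonpos) (auto simp: n_def)
    ultimately show ?thesis by linarith
  next
    case True
    then obtain M where N: "N = Suc (Suc M)" by (metis add_2_eq_Suc le_Suc_ex)
    define m where "m = real M"
    have nm: "n = m + 4" by (simp add: n_def N m_def)
    have S: "S = (m + 1) * binsum M (\<lambda>k. recip3 (k + 2))"
      unfolding S_def N m_def by (rule sum_changes_isolated)
    have "(m + 2) * ((n - 1) * n * (n + 1) * S) \<ge>
        2 ^ (M + 5) * ((m + 5) * (m + 6) / 4 - 7 * (m + 5) / 2 + 15 / 2)"
      using binsum_recip3_shift[of M] by (simp add: S nm m_def algebra_simps)
    \<comment> \<open>The polynomial is \<open>(m + 2) * (m - 5) / 4\<close>, with
      \<open>m - 5 = n - 9\<close> and \<open>2 ^ (M + 5) = 8 * P\<close>; the factor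
      \<open>m + 2\<close> then cancels.\<close>
    also have "2 ^ (M + 5) * ((m + 5) * (m + 6) / 4 - 7 * (m + 5) / 2 + 15 / 2) =
        (m + 2) * (2 * P * (n - 9))"
      by (simp add: P_def N nm power_add field_simps)
    finally show ?thesis
      by (rule mult_left_le_imp_le) (simp add: m_def)
  qed
  let ?T = "binsum N (\<lambda>k. 1 / (real k + 1)) + 2 * binsum N recip3 - 2 * S"
  have "(n - 1) * n * (n + 1) * ?T \<le> n * (n + 1) * (2 * P) + 2 * (8 * P) - 2 * (2 * P * (n - 9))"
  proof -
    have "n * (n + 1) * ((n - 1) * binsum N (\<lambda>k. 1 / (real k + 1))) \<le> n * (n + 1) * (2 * P)"
      using 1 n by (intro mult_left_mono) auto
    then show ?thesis using 2 3 by (simp add: algebra_simps)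
  qed
  \<comment> \<open>The constant 26 is 8 from the \<open>recip3\<close> sum plus 18 from the -9 in
    the bound on \<open>S\<close>.\<close>
  also have "\<dots> = 2 * P * (n * (n - 1) + 26)" by (simp add: algebra_simps)
  finally have "?T \<le> 2 * P * (n * (n - 1) + 26) / ((n - 1) * n * (n + 1))"
    using n by (simp add: pos_le_divide_eq mult.commute)
  also have "\<dots> = 2 ^ (N + 1) / (n + 1) * (1 + 26 / (n * (n - 1)))"
    using n by (simp add: P_def field_simps)
  finally show ?thesis unfolding sum_weight_Cons S_def .
qed

theorem theorem2:
  fixes n :: nat
  assumes "n \<ge> 2"
  shows "kappa_star single_deletion (bin_strings n) (bin_strings (n - 1))
           \<le> 2 ^ n / (real n + 1) * (1 + 26 / (real n * (real n - 1)))"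
proof -
  obtain N where n: "n = Suc (Suc N)" using assms by (metis add_2_eq_Suc le_Suc_ex)
  have "kappa_star single_deletion (bin_strings n) (bin_strings (n - 1))
      \<le> (\<Sum>y\<in>bin_strings (n - 1). weight (changes y) (isolated y))"
    using weight_changes_isolated_nonneg weight_covers[OF assms] by (rule kappa_star_le)
  \<comment> \<open>The factor 2 counts the choices of the first letter.\<close>
  also have "\<dots> \<le> 2 * (2 ^ (N + 1) / (real n + 1) * (1 + 26 / (real n * (real n - 1))))"
    using sum_weight_Cons_le[of True N] sum_weight_Cons_le[of False N]
    by (simp add: n sum_bin_strings_Suc[of _ N True] add.commute)
  finally show ?thesis by (simp add: n)
qed

end
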